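(* For $n\ge0$ let $p_n$, $s_n$, $f_n$ and $e_n$ be the numbers of, respectively, all polydiagonal subspaces, synchrony subspaces, fully tagged polydiagonal subspaces, and evenly tagged polydiagonal subspaces of $\mathbb{R}^n$. If $n\ge0$, then \begin{itemize} \item $\displaystyle p_{n+1}=p_n+\sum_{k+\ell<n}\binom{n}{k\ \ell}p_k+\sum_{k=0}^n\binom{n}{k}p_k$, \item $\displaystyle s_{n+1}=\sum_{k=0}^n\binom{n}{k}s_k$, \item $\displaystyle f_{n+1}=f_n+\sum_{k+\ell<n}\binom{n}{k\ \ell}f_k$, \item $\displaystyle e_{n+1}=e_n+\sum_{k+2\ell+1=n}\binom{n}{k\ \ell}e_k$, \end{itemize} where the sums indexed by $k,\ell$ run over all pairs of nonnegative integers $(k,\ell)$ satisfying the indicated condition, and $\binom{n}{k\ \ell}=\frac{n!}{k!\,\ell!\,(n-k-\ell)!}$.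
   Context: A partial involution on a set $X$ is a map $x\mapsto x^*:\tilde X\to\tilde X$ defined on a (possibly empty) subset $\tilde X\subseteq X$ that is its own inverse. A tagged partition of a finite set $C$ is a partition $\mathcal{P}$ of $C$ (into nonempty classes) together with a partial involution $P\mapsto P^*$ on $\mathcal{P}$ that has at most one fixed point. The class of $i$ is denoted by $[i]$. For a tagged partition $\mathcal{P}$ of $\{1,\ldots,n\}$, the polydiagonal subspace is $$\Delta_{\mathcal{P}}=\{x\in\mathbb{R}^n\mid x_i=x_j\text{ if }[i]=[j],\text{ and }x_i=-x_j\text{ if }[i]^*=[j]\},$$ and $\mathcal{P}\mapsto\Delta_{\mathcal{P}}$ is a bijection from tagged partitions of $\{1,\ldots,n\}$ to polydiagonal subspaces of $\mathbb{R}^n$. $\Delta_{\mathcal{P}}$ is a synchrony subspace if the partial involution is the empty function; fully tagged if the partial involution is defined on all of $\mathcal{P}$; and evenly tagged if it is fully tagged and $\#P=\#P^*$ for all $P\in\mathcal{P}$. For $n=0$ the only tagged partition is the empty one (with empty partial involution); its polydiagonal subspace $\mathbb{R}^0$ is an evenly and fully tagged synchrony subspace, so $p_0=s_0=f_0=e_0=1$. *)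

theory Defs
  imports Complex_Main "HOL-Library.Disjoint_Sets" "HOL-Library.FuncSet"
begin

text \<open>
  A partial function that is its own inverse automatically maps its domain to its domain.
\<close>

definition partial_involution_on :: "'a set \<Rightarrow> ('a \<rightharpoonup> 'a) \<Rightarrow> bool" where
  "partial_involution_on X t \<longleftrightarrow> dom t \<subseteq> X \<and> (\<forall>x y. t x = Some y \<longrightarrow> t y = Some x)"

definition tagged_partition :: "'a set \<Rightarrow> 'a set set \<Rightarrow> ('a set \<rightharpoonup> 'a set) \<Rightarrow> bool" where
  "tagged_partition C P t \<longleftrightarrow>
     finite C \<and> partition_on C P \<and> partial_involution_on P t \<and>
     (\<forall>A B. t A = Some A \<longrightarrow> t B = Some B \<longrightarrow> A = B)"

definition fully_tagged :: "'a set set \<Rightarrow> ('a set \<rightharpoonup> 'a set) \<Rightarrow> bool" where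
  "fully_tagged P t \<longleftrightarrow> dom t = P"

definition evenly_tagged :: "'a set set \<Rightarrow> ('a set \<rightharpoonup> 'a set) \<Rightarrow> bool" where
  "evenly_tagged P t \<longleftrightarrow> fully_tagged P t \<and> (\<forall>A B. t A = Some B \<longrightarrow> card A = card B)"

definition class_of :: "'a set set \<Rightarrow> 'a \<Rightarrow> 'a set" where
  "class_of P i = (THE A. A \<in> P \<and> i \<in> A)"

text \<open>
  Vectors in \<open>\<real>\<^sup>n\<close> are the extensional functions on \<open>{1..n}\<close>, so that
  distinct vectors are distinct functions and \<open>\<real>\<^sup>0\<close> is a singleton.
\<close>

definition polydiagonal :: "nat \<Rightarrow> nat set set \<Rightarrow> (nat set \<rightharpoonup> nat set) \<Rightarrow> (nat \<Rightarrow> real) set" where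
  "polydiagonal n P t =
     {x \<in> {1..n} \<rightarrow>\<^sub>E UNIV. \<forall>i\<in>{1..n}. \<forall>j\<in>{1..n}.
        (class_of P i = class_of P j \<longrightarrow> x i = x j) \<and>
        (t (class_of P i) = Some (class_of P j) \<longrightarrow> x i = - x j)}"

definition polydiagonal_subspaces :: "nat \<Rightarrow> (nat \<Rightarrow> real) set set" where
  "polydiagonal_subspaces n = {polydiagonal n P t | P t. tagged_partition {1..n} P t}"

definition synchrony_subspaces :: "nat \<Rightarrow> (nat \<Rightarrow> real) set set" where
  "synchrony_subspaces n =
     {polydiagonal n P t | P t. tagged_partition {1..n} P t \<and> t = Map.empty}"

definition fully_tagged_subspaces :: "nat \<Rightarrow> (nat \<Rightarrow> real) set set" where
  "fully_tagged_subspaces n =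
     {polydiagonal n P t | P t. tagged_partition {1..n} P t \<and> fully_tagged P t}"

definition evenly_tagged_subspaces :: "nat \<Rightarrow> (nat \<Rightarrow> real) set set" where
  "evenly_tagged_subspaces n =
     {polydiagonal n P t | P t. tagged_partition {1..n} P t \<and> evenly_tagged P t}"

definition num_polydiagonal :: "nat \<Rightarrow> nat" where
  "num_polydiagonal n = card (polydiagonal_subspaces n)"

definition num_synchrony :: "nat \<Rightarrow> nat" where
  "num_synchrony n = card (synchrony_subspaces n)"

definition num_fully_tagged :: "nat \<Rightarrow> nat" where
  "num_fully_tagged n = card (fully_tagged_subspaces n)"

definition num_evenly_tagged :: "nat \<Rightarrow> nat" where
  "num_evenly_tagged n = card (evenly_tagged_subspaces n)"

text \<open>
  The division is exact, and the subtraction does not truncate, for \<open>k + l \<le> n\<close>; see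
  \<open>of_nat_trinomial\<close> below. Other arguments are not used.
\<close>

definition trinomial :: "nat \<Rightarrow> nat \<Rightarrow> nat \<Rightarrow> nat" where
  "trinomial n k l = fact n div (fact k * fact l * fact (n - k - l))"

lemma trinomial_eq_binomial:
  assumes "k + l \<le> n"
  shows "trinomial n k l = (n choose k) * ((n - k) choose l)"
proof -
  have "fact n = fact k * (fact l * fact (n - k - l) * ((n - k) choose l)) * (n choose k)"
    using binomial_fact_lemma[of k n] binomial_fact_lemma[of l "n - k"] assms
    by (simp add: ac_simps)
  then have "fact n = (fact k * fact l * fact (n - k - l)) * ((n choose k) * ((n - k) choose l))"
    by (simp only: ac_simps)
  then show ?thesis
    unfolding trinomial_def by (metis fact_nonzero mult_eq_0_iff nonzero_mult_div_cancel_left)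
qed

lemma of_nat_trinomial:
  assumes "k + l \<le> n"
  shows "real (trinomial n k l) = fact n / (fact k * fact l * fact (n - k - l))"
  using assms by (simp add: trinomial_eq_binomial binomial_fact)

end

theory Submission
  imports Defs
begin

text \<open>
  A tagged partition can be recovered from its polydiagonal subspace, because classes and tags are
  exactly the relations \<open>x i = x j\<close> and \<open>x i = - x j\<close> that hold on the subspace; the
  vector that separates two classes is the signed indicator of one that is not its own partner.
  So tagged partitions are counted instead, and sorted by the class of the new point \<open>n + 1\<close>.
  If it is untagged, removing it leaves a tagged partition of any subset of the other points. If it
  is its own partner, deleting just the point \<open>n + 1\<close> (and the class, should it become empty)
  leaves an arbitrary tagged partition of the other points. If its partner is another class,
  removing both leaves a tagged partition of \<open>k\<close> points, where \<open>l\<close> other points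
  share the class of \<open>n + 1\<close> and the remaining \<open>n - k - l > 0\<close> points form the partner.
\<close>

section \<open>Tagged partitions with restricted kinds of classes\<close>

text \<open>
  The parameters describe which classes may occur: \<open>u\<close> allows untagged classes, \<open>z\<close>
  allows a fixed point of the involution, and \<open>r\<close> restricts the sizes of two distinct
  partners. The four families of the theorem are all of this form.
\<close>

definition tagged_parts ::
  "bool \<Rightarrow> (nat \<Rightarrow> nat \<Rightarrow> bool) \<Rightarrow> bool \<Rightarrow> 'a set \<Rightarrow> ('a set set \<times> ('a set \<rightharpoonup> 'a set)) set" where
  "tagged_parts u r z C = {(P, t). tagged_partition C P t \<and> (u \<or> P \<subseteq> dom t) \<and>
     (\<forall>A B. t A = Some B \<longrightarrow> (if A = B then z else r (card A) (card B)))}"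

text \<open>The pair \<open>(Q, v)\<close> will be a tagged partition of a subset of
  \<open>C\<close> that has to occur as it stands. A value \<open>None\<close> of \<open>v\<close>
  is a prescription as well: that class must be untagged.\<close>

definition tagged_parts_over ::
  "bool \<Rightarrow> (nat \<Rightarrow> nat \<Rightarrow> bool) \<Rightarrow> bool \<Rightarrow> 'a set \<Rightarrow> 'a set set \<Rightarrow> ('a set \<rightharpoonup> 'a set) \<Rightarrow>
    ('a set set \<times> ('a set \<rightharpoonup> 'a set)) set" where
  "tagged_parts_over u r z C Q v = {(P, t) \<in> tagged_parts u r z C. Q \<subseteq> P \<and> (\<forall>A\<in>Q. t A = v A)}"

lemma tagged_partsD:
  assumes "(P, t) \<in> tagged_parts u r z C"
  shows "partition_on C P" "dom t \<subseteq> P" "\<And>A B. t A = Some B \<Longrightarrow> t B = Some A"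
    "\<And>A B. t A = Some A \<Longrightarrow> t B = Some B \<Longrightarrow> A = B"
    "\<And>A B. t A = Some B \<Longrightarrow> (if A = B then z else r (card A) (card B))"
    "u \<or> P \<subseteq> dom t" "\<And>A B. t A = Some B \<Longrightarrow> B \<in> P"
proof -
  show "partition_on C P" "dom t \<subseteq> P" and t: "\<And>A B. t A = Some B \<Longrightarrow> t B = Some A"
    and "\<And>A B. t A = Some A \<Longrightarrow> t B = Some B \<Longrightarrow> A = B"
    "\<And>A B. t A = Some B \<Longrightarrow> (if A = B then z else r (card A) (card B))"
    "u \<or> P \<subseteq> dom t"
    using assms
    unfolding tagged_parts_def tagged_partition_def partial_involution_on_def mem_Collect_eq prod.case
    by blast+
  then show "\<And>A B. t A = Some B \<Longrightarrow> B \<in> P" by blast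
qed

lemma tagged_partsI:
  assumes "finite C" "partition_on C P" "dom t \<subseteq> P" "\<And>A B. t A = Some B \<Longrightarrow> t B = Some A"
    "\<And>A B. t A = Some A \<Longrightarrow> t B = Some B \<Longrightarrow> A = B"
    "\<And>A B. t A = Some B \<Longrightarrow> (if A = B then z else r (card A) (card B))"
    "u \<or> P \<subseteq> dom t"
  shows "(P, t) \<in> tagged_parts u r z C"
  unfolding tagged_parts_def tagged_partition_def partial_involution_on_def mem_Collect_eq prod.case
  using assms by (intro conjI allI impI)

section \<open>Auxiliary facts on partitions, finiteness and classes\<close>

lemma partition_on_Un:
  assumes "partition_on A P" "partition_on B Q" "A \<inter> B = {}"
  shows "partition_on (A \<union> B) (P \<union> Q)"
  unfolding partition_on_def
proof (intro conjI disjointI)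
  fix p q assume "p \<in> P \<union> Q" "q \<in> P \<union> Q" "p \<noteq> q"
  moreover have "p \<inter> q = {}" if "p \<in> P" "q \<in> P" "p \<noteq> q" for p q
    using assms(1) that by (meson disjointD partition_onD2)
  moreover have "p \<inter> q = {}" if "p \<in> Q" "q \<in> Q" "p \<noteq> q" for p q
    using assms(2) that by (meson disjointD partition_onD2)
  moreover have "p \<inter> q = {}" if "p \<in> P" "q \<in> Q" for p q
    using assms that partition_onD1 by blast
  ultimately show "p \<inter> q = {}" by (metis Int_commute Un_iff)
qed (use assms in \<open>auto simp: partition_on_def\<close>)

lemma partition_on_Diff:
  assumes "partition_on A P" "partition_on B Q" "Q \<subseteq> P"
  shows "partition_on (A - B) (P - Q)"
  unfolding partition_on_def
proof (intro conjI)
  have "p \<inter> q = {}" if "p \<in> P - Q" "q \<in> Q" for p q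
    using assms that by (metis Diff_iff disjointD partition_onD2 subsetD)
  then have "\<Union>(P - Q) = \<Union>P - \<Union>Q" by blast
  then show "\<Union>(P - Q) = A - B" using assms(1,2) by (simp add: partition_on_def)
  show "disjoint (P - Q)" using assms(1) by (meson Diff_subset partition_onD2 pairwise_subset)
qed (use assms(1) in \<open>auto simp: partition_on_def\<close>)

lemma finite_tagged_parts:
  assumes "finite C"
  shows "finite (tagged_parts u r z C)"
proof -
  \<comment> \<open>The maps are sorted by domain because \<open>finite_set_of_finite_maps\<close>
    covers maps with one given domain.\<close>
  let ?M = "\<lambda>P. \<Union>D\<in>Pow P. {t. dom t = D \<and> ran t \<subseteq> P}"
  have "tagged_parts u r z C \<subseteq> Sigma (Pow (Pow C)) ?M"
  proof clarsimp
    fix P t assume "(P, t) \<in> tagged_parts u r z C"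
    note t = tagged_partsD[OF this]
    have "ran t \<subseteq> P" using t(7) unfolding ran_def by blast
    moreover have "P \<subseteq> Pow C" using t(1) by (auto simp: partition_on_def)
    ultimately show "P \<subseteq> Pow C \<and> dom t \<subseteq> P \<and> ran t \<subseteq> P" using t(2) by blast
  qed
  moreover have "finite (Sigma (Pow (Pow C)) ?M)"
  proof (intro finite_SigmaI)
    fix P assume "P \<in> Pow (Pow C)"
    then have P: "finite P" using assms by (meson PowD finite_Pow_iff finite_subset)
    then have "finite {t. dom t = D \<and> ran t \<subseteq> P}" if "D \<subseteq> P" for D
      using that by (auto intro!: finite_set_of_finite_maps intro: finite_subset)
    then show "finite (?M P)" using P by auto
  qed (use assms in auto)
  ultimately show ?thesis by (rule finite_subset)
qed

lemma class_of_eq: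
  assumes "partition_on C P" "A \<in> P" "i \<in> A"
  shows "class_of P i = A"
  unfolding class_of_def
  using assms by (intro the_equality) (auto simp: partition_on_def disjoint_def)

lemma class_of_mem:
  assumes "partition_on C P" "i \<in> C"
  shows "class_of P i \<in> P" "i \<in> class_of P i"
proof -
  obtain A where "A \<in> P" "i \<in> A" using assms by (auto simp: partition_on_def)
  then show "class_of P i \<in> P" "i \<in> class_of P i" using class_of_eq[OF assms(1)] by auto
qed

section \<open>Deleting and gluing prescribed classes\<close>

text \<open>Because \<open>v\<close> maps into \<open>Q\<close> and is symmetric, no class outside
  \<open>Q\<close> has its partner in \<open>Q\<close>; so deleting \<open>Q\<close> and gluing it
  back are inverse to each other. At most one fixed point is allowed in total, hence the rest may
  have one only if \<open>v\<close> has none; this is the meaning of \<open>z'\<close>.\<close>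

lemma bij_betw_glue:
  assumes Qv: "(Q, v) \<in> tagged_parts u r z E" and "E \<subseteq> C" "finite C"
    and z': "z' \<longleftrightarrow> z \<and> (\<forall>A. v A \<noteq> Some A)"
  shows "bij_betw (\<lambda>(P, t). (P \<union> Q, t ++ v)) (tagged_parts u r z' (C - E)) (tagged_parts_over u r z C Q v)"
proof -
  note v = tagged_partsD[OF Qv]
  have Q: "\<Union>Q = E" "{} \<notin> Q" using v(1) by (auto simp: partition_on_def)
  have disj: "P \<inter> Q = {}" if "(P, t) \<in> tagged_parts u r z' (C - E)" for P t
  proof -
    have "A = {}" if "A \<in> P" "A \<in> Q" for A
      using that tagged_partsD(1)[OF \<open>(P, t) \<in> _\<close>] Q(1) unfolding partition_on_def by blast
    then show ?thesis using Q(2) by blast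
  qed
  have over: "(P, t) \<in> tagged_parts u r z C" "Q \<subseteq> P" "\<And>A. A \<in> Q \<Longrightarrow> t A = v A"
    if "(P, t) \<in> tagged_parts_over u r z C Q v" for P t
    using that unfolding tagged_parts_over_def by blast+
  have vN: "v A = None" if "A \<notin> Q" for A using that v(2) by blast
  have tN: "t A = None" if "(P, t) \<in> tagged_parts u r z' (C - E)" "A \<in> Q" for P t A
    using that(2) disj[OF that(1)] tagged_partsD(2)[OF that(1)] by blast
  let ?g = "\<lambda>(P, t). (P - Q, t |` (- Q))"
  show ?thesis
  proof (rule bij_betw_byWitness[where f' = ?g])
    have "P \<union> Q - Q = P" "(t ++ v) |` (- Q) = t" if a: "(P, t) \<in> tagged_parts u r z' (C - E)" for P t
    proof -
      have "((t ++ v) |` (- Q)) A = t A" for A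
        using tN[OF a, of A] vN[of A] by (cases "A \<in> Q") (simp_all add: map_add_def)
      then show "(t ++ v) |` (- Q) = t" by (rule ext)
      show "P \<union> Q - Q = P" using disj[OF a] by blast
    qed
    then show "\<forall>a\<in>tagged_parts u r z' (C - E). ?g ((\<lambda>(P, t). (P \<union> Q, t ++ v)) a) = a" by auto
    have "P - Q \<union> Q = P" "(t |` (- Q)) ++ v = t" if a: "(P, t) \<in> tagged_parts_over u r z C Q v" for P t
    proof -
      have "((t |` (- Q)) ++ v) A = t A" for A
        using over(3)[OF a, of A] vN[of A]
        by (cases "A \<in> Q") (simp_all add: map_add_def split: option.split)
      then show "(t |` (- Q)) ++ v = t" by (rule ext)
      show "P - Q \<union> Q = P" using over(2)[OF a] by blast
    qed
    then show "\<forall>a\<in>tagged_parts_over u r z C Q v. (\<lambda>(P, t). (P \<union> Q, t ++ v)) (?g a) = a"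
      by (auto simp del: Un_Diff_cancel2)
    show "(\<lambda>(P, t). (P \<union> Q, t ++ v)) ` tagged_parts u r z' (C - E) \<subseteq> tagged_parts_over u r z C Q v"
    proof clarsimp
      fix P t assume a: "(P, t) \<in> tagged_parts u r z' (C - E)"
      note s = tagged_partsD[OF a] and d = disj[OF a]
      have split: "(t ++ v) A = Some B \<longleftrightarrow> t A = Some B \<or> v A = Some B" for A B
        using tN[OF a, of A] vN[of A]
        by (cases "A \<in> Q") (simp_all add: map_add_def split: option.split)
      have "partition_on C (P \<union> Q)"
        using partition_on_Un[OF s(1) v(1)] \<open>E \<subseteq> C\<close> by (simp add: Un_absorb2 Diff_Int_distrib2)
      moreover have "dom (t ++ v) \<subseteq> P \<union> Q" using s(2) v(2) by auto
      moreover have "(t ++ v) B = Some A" if "(t ++ v) A = Some B" for A B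
        using that s(3) v(3) unfolding split by blast
      \<comment> \<open>A fixed point of \<open>t\<close> forces \<open>z'\<close>, which excludes
        fixed points of \<open>v\<close>; so both fixed points come from the same map.\<close>
      moreover have "A = B" if "(t ++ v) A = Some A" "(t ++ v) B = Some B" for A B
        using that s(4)[of A B] v(4)[of A B] s(5)[of A A] s(5)[of B B] z' unfolding split by auto
      moreover have "u \<or> P \<union> Q \<subseteq> dom (t ++ v)" using s(6) v(6) by auto
      moreover have "if A = B then z else r (card A) (card B)" if "(t ++ v) A = Some B" for A B
        using that s(5)[of A B] v(5)[of A B] z' unfolding split by (auto split: if_splits)
      ultimately have "(P \<union> Q, t ++ v) \<in> tagged_parts u r z C"
        using \<open>finite C\<close> by (intro tagged_partsI)
      moreover have "(t ++ v) A = v A" if "A \<in> Q" for A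
        using tN[OF a that] by (simp add: map_add_def split: option.splits)
      ultimately show "(P \<union> Q, t ++ v) \<in> tagged_parts_over u r z C Q v"
        unfolding tagged_parts_over_def by blast
    qed
    show "?g ` tagged_parts_over u r z C Q v \<subseteq> tagged_parts u r z' (C - E)"
    proof clarsimp
      fix P t assume a: "(P, t) \<in> tagged_parts_over u r z C Q v"
      note l = tagged_partsD[OF over(1)[OF a]] and o = over(2,3)[OF a]
      have rs: "(t |` (- Q)) A = Some B \<longleftrightarrow> A \<notin> Q \<and> t A = Some B" for A B
        by (simp add: restrict_map_def)
      \<comment> \<open>If the partner \<open>B\<close> were in \<open>Q\<close>, then
        \<open>v B = t B = Some A\<close>, and the values of \<open>v\<close> lie in
        \<open>Q\<close>.\<close>
      have cl: "B \<notin> Q" if "A \<notin> Q" "t A = Some B" for A B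
        using that o(2)[of B] l(3)[of A B] v(7)[of B A] by auto
      have "partition_on (C - E) (P - Q)"
        using l(1) v(1) o(1) by (rule partition_on_Diff)
      moreover have "dom (t |` (- Q)) \<subseteq> P - Q" using l(2) by auto
      moreover have "(t |` (- Q)) B = Some A" if "(t |` (- Q)) A = Some B" for A B
        using that l(3) cl unfolding rs by blast
      moreover have "A = B" if "(t |` (- Q)) A = Some A" "(t |` (- Q)) B = Some B" for A B
        using that l(4) unfolding rs by blast
      moreover have "u \<or> P - Q \<subseteq> dom (t |` (- Q))" using l(6) by auto
      moreover have "if A = B then z' else r (card A) (card B)" if "(t |` (- Q)) A = Some B" for A B
      proof (cases "A = B")
        case True
        with that have A: "A \<notin> Q" "t A = Some A" unfolding rs by auto
        \<comment> \<open>A fixed point \<open>D\<close> of \<open>v\<close> is one of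
          \<open>t\<close> too, so it would be \<open>A\<close>; but \<open>D\<close> lies in
          \<open>Q\<close> and \<open>A\<close> does not.\<close>
        have "v D \<noteq> Some D" for D
          using l(4)[of A D] o(2)[of D] A v(7) by metis
        then show ?thesis using l(5)[OF A(2)] True z' by simp
      qed (use that l(5)[of A B] rs in auto)
      ultimately show "(P - Q, t |` (- Q)) \<in> tagged_parts u r z' (C - E)"
        using finite_Diff[OF \<open>finite C\<close>] by (intro tagged_partsI)
    qed
  qed
qed

lemma card_tagged_parts_over:
  assumes "(Q, v) \<in> tagged_parts u r z E" "E \<subseteq> C" "finite C"
  shows "card (tagged_parts_over u r z C Q v) = card (tagged_parts u r (z \<and> (\<forall>A. v A \<noteq> Some A)) (C - E))"
  using bij_betw_same_card[OF bij_betw_glue[OF assms refl]] by simp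

lemma finite_tagged_parts_over: "finite C \<Longrightarrow> finite (tagged_parts_over u r z C Q v)"
  by (rule finite_subset[OF _ finite_tagged_parts]) (auto simp: tagged_parts_over_def)

text \<open>The self-paired class uses up the only fixed point, hence \<open>False\<close> for the
  rest.\<close>

lemma card_tagged_parts_over_fixed:
  assumes "finite C" "F \<subseteq> C" "F \<noteq> {}"
  shows "card (tagged_parts_over u r True C {F} [F \<mapsto> F]) = card (tagged_parts u r False (C - F))"
proof -
  have "({F}, [F \<mapsto> F]) \<in> tagged_parts u r True F"
    using assms by (intro tagged_partsI) (auto simp: partition_on_space intro: finite_subset split: if_splits)
  from card_tagged_parts_over[OF this assms(2,1)] show ?thesis by simp
qed

lemma card_tagged_parts_over_untagged:
  assumes "finite C" "A \<subseteq> C" "A \<noteq> {}"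
  shows "card (tagged_parts_over True r z C {A} Map.empty) = card (tagged_parts True r z (C - A))"
proof -
  have "({A}, Map.empty) \<in> tagged_parts True r z A"
    using assms by (intro tagged_partsI) (auto simp: partition_on_space intro: finite_subset)
  from card_tagged_parts_over[OF this assms(2,1)] show ?thesis by simp
qed

text \<open>The size condition is tested on each ordered pair \<open>t A = Some B\<close>, and the
  map contains the pair in both orders, so \<open>r\<close> is required twice.\<close>

lemma card_tagged_parts_over_pair:
  assumes "finite C" "A \<subseteq> C" "B \<subseteq> C" "A \<noteq> {}" "B \<noteq> {}" "A \<inter> B = {}"
    and r: "r (card A) (card B)" "r (card B) (card A)"
  shows "card (tagged_parts_over u r z C {A, B} [A \<mapsto> B, B \<mapsto> A]) = card (tagged_parts u r z (C - (A \<union> B)))"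
proof -
  have "A \<noteq> B" using assms by auto
  have "partition_on (A \<union> B) ({A} \<union> {B})"
    using assms by (intro partition_on_Un partition_on_space)
  then have p: "partition_on (A \<union> B) {A, B}" by (simp add: insert_commute)
  have "({A, B}, [A \<mapsto> B, B \<mapsto> A]) \<in> tagged_parts u r z (A \<union> B)"
  proof (rule tagged_partsI[OF _ p])
    show "finite (A \<union> B)" using assms by (auto intro: finite_subset)
  qed (use \<open>A \<noteq> B\<close> r in \<open>auto split: if_splits\<close>)
  from card_tagged_parts_over[OF this _ assms(1)] show ?thesis using assms(2,3) \<open>A \<noteq> B\<close> by simp
qed

text \<open>
  The set \<open>S\<close> is the self-paired class, or empty if there is none. For a self-paired class
  containing a new point \<open>x\<close> the same sum arises with \<open>S\<close> the rest of that class.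
\<close>

lemma card_tagged_parts_True:
  assumes "finite C"
  shows "card (tagged_parts u r True C) = (\<Sum>S\<in>Pow C. card (tagged_parts u r False (C - S)))"
proof -
  let ?G = "\<lambda>F. tagged_parts_over u r True C {F} [F \<mapsto> F]"
  \<comment> \<open>A class is never empty, which leaves \<open>S = {}\<close> as the index for the
    case without a fixed point.\<close>
  have "tagged_parts u r True C = tagged_parts u r False C \<union> (\<Union>F\<in>Pow C - {{}}. ?G F)"
  proof (intro equalityI subrelI)
    fix P t assume a: "(P, t) \<in> tagged_parts u r True C"
    show "(P, t) \<in> tagged_parts u r False C \<union> (\<Union>F\<in>Pow C - {{}}. ?G F)"
    proof (cases "\<exists>F. t F = Some F")
      case True
      then obtain F where F: "t F = Some F" by blast
      then have "F \<in> P" using tagged_partsD(7)[OF a] by blast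
      then have "F \<in> Pow C - {{}}" using tagged_partsD(1)[OF a] by (auto simp: partition_on_def)
      moreover have "(P, t) \<in> ?G F" using a F \<open>F \<in> P\<close> by (simp add: tagged_parts_over_def)
      ultimately show ?thesis by blast
    next
      case False
      then show ?thesis using a unfolding tagged_parts_def by auto
    qed
  next
    fix P t assume "(P, t) \<in> tagged_parts u r False C \<union> (\<Union>F\<in>Pow C - {{}}. ?G F)"
    then show "(P, t) \<in> tagged_parts u r True C"
      unfolding tagged_parts_over_def tagged_parts_def by (auto split: if_splits)
  qed
  moreover have "tagged_parts u r False C \<inter> (\<Union>F\<in>Pow C - {{}}. ?G F) = {}"
    unfolding tagged_parts_over_def tagged_parts_def by force
  moreover have "card (\<Union>F\<in>Pow C - {{}}. ?G F) = (\<Sum>F\<in>Pow C - {{}}. card (?G F))"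
  proof (rule card_UN_disjoint)
    show "\<forall>F\<in>Pow C - {{}}. \<forall>F'\<in>Pow C - {{}}. F \<noteq> F' \<longrightarrow> ?G F \<inter> ?G F' = {}"
    proof (intro ballI impI equals0I)
      fix F F' y assume "F \<noteq> F'" and y: "y \<in> ?G F \<inter> ?G F'"
      obtain P t where "y = (P, t)" by fastforce
      with y have "(P, t) \<in> tagged_parts u r True C" "t F = Some F" "t F' = Some F'"
        by (simp_all add: tagged_parts_over_def)
      with \<open>F \<noteq> F'\<close> show False using tagged_partsD(4) by blast
    qed
  qed (use assms in \<open>auto simp: finite_tagged_parts_over\<close>)
  moreover have "(\<Sum>F\<in>Pow C - {{}}. card (?G F)) = (\<Sum>F\<in>Pow C - {{}}. card (tagged_parts u r False (C - F)))"
    using assms by (intro sum.cong) (auto simp: card_tagged_parts_over_fixed)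
  moreover have "(\<Sum>S\<in>Pow C. card (tagged_parts u r False (C - S))) =
      card (tagged_parts u r False C) + (\<Sum>F\<in>Pow C - {{}}. card (tagged_parts u r False (C - F)))"
    using assms by (subst sum.remove[of _ "{}"]) auto
  ultimately show ?thesis
    using assms by (simp add: card_Un_disjoint finite_tagged_parts finite_tagged_parts_over)
qed

section \<open>Sorting by the class of a new point\<close>

lemma sum_Pow_card:
  fixes g :: "nat \<Rightarrow> nat"
  assumes "finite C"
  shows "(\<Sum>S\<in>Pow C. g (card S)) = (\<Sum>k\<le>card C. (card C choose k) * g k)"
proof -
  have "(\<Sum>S\<in>Pow C. g (card S)) = (\<Sum>k\<le>card C. \<Sum>S\<in>{S \<in> Pow C. card S = k}. g (card S))"
    using assms by (intro sum.group[symmetric]) (auto intro: card_mono)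
  also have "\<dots> = (\<Sum>k\<le>card C. (card C choose k) * g k)"
    using n_subsets[OF assms] by (intro sum.cong) auto
  finally show ?thesis .
qed

text \<open>An index that can be computed from each member makes the sets disjoint. Below, it is
  read off from the class of the new point and its partner.\<close>

lemma card_UN_key:
  assumes "\<And>i y. i \<in> I \<Longrightarrow> y \<in> G i \<Longrightarrow> key y = i" "finite I" "\<And>i. i \<in> I \<Longrightarrow> finite (G i)"
  shows "card (\<Union>i\<in>I. G i) = (\<Sum>i\<in>I. card (G i))"
proof (rule card_UN_disjoint)
  show "\<forall>i\<in>I. \<forall>j\<in>I. i \<noteq> j \<longrightarrow> G i \<inter> G j = {}" using assms(1) by (metis disjoint_iff)
qed (use assms in auto)

text \<open>The three summands are the cases in which the class of \<open>x\<close> is untagged, its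
  own partner, or paired with another class. In the last case \<open>K\<close> collects the points
  outside both classes, \<open>insert x S\<close> is the class of \<open>x\<close>, and
  \<open>C - K - S\<close> is its partner; excluding \<open>S = C - K\<close> keeps the partner
  nonempty.\<close>

lemma card_tagged_parts_insert:
  assumes C: "finite C" "x \<notin> C" and r: "\<And>a b. r a b = r b a"
  shows "card (tagged_parts u r z (insert x C)) =
      (if u then \<Sum>S\<in>Pow C. card (tagged_parts u r z (C - S)) else 0)
    + (if z then card (tagged_parts u r True C) else 0)
    + (\<Sum>K\<in>Pow C. \<Sum>S\<in>Pow (C - K) - {C - K}.
         if r (card S + 1) (card (C - K) - card S) then card (tagged_parts u r z K) else 0)"
proof -
  let ?C = "insert x C"
  let ?X = "tagged_parts u r z ?C"
  let ?X1 = "{(P, t) \<in> ?X. t (class_of P x) = None}"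
  let ?X2 = "{(P, t) \<in> ?X. t (class_of P x) = Some (class_of P x)}"
  let ?X3 = "{(P, t) \<in> ?X. t (class_of P x) \<noteq> None \<and> t (class_of P x) \<noteq> Some (class_of P x)}"
  have C': "finite ?C" using C by simp
  have cls: "class_of P x = A" if "(P, t) \<in> ?X" "A \<in> P" "x \<in> A" for P t A
    using class_of_eq[OF tagged_partsD(1)[OF that(1)]] that by blast
  have cls_mem: "class_of P x \<in> P" "class_of P x = insert x (class_of P x - {x})"
      "class_of P x - {x} \<in> Pow C"
    if "(P, t) \<in> ?X" for P t
  proof -
    show a: "class_of P x \<in> P" using class_of_mem(1)[OF tagged_partsD(1)[OF that]] by simp
    show "class_of P x = insert x (class_of P x - {x})"
      using class_of_mem(2)[OF tagged_partsD(1)[OF that]] by auto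
    show "class_of P x - {x} \<in> Pow C"
      using a tagged_partsD(1)[OF that] by (auto simp: partition_on_def)
  qed
  \<comment> \<open>The prescribed class \<open>insert x S\<close> contains \<open>x\<close>, hence
    is the class of \<open>x\<close>; its tag under \<open>v\<close> thus decides between the three
    cases.\<close>
  have overD: "(P, t) \<in> ?X" "class_of P x = insert x S" "t (insert x S) = v (insert x S)"
    if "(P, t) \<in> tagged_parts_over u r z ?C Q v" "insert x S \<in> Q" for P t Q v S
    using that cls[of P t "insert x S"] unfolding tagged_parts_over_def by auto
  have fin: "finite ?X1" "finite ?X2" "finite ?X3"
    by (rule finite_subset[OF _ finite_tagged_parts[OF C', of u r z]]; blast)+

  have dec: "?X = ?X1 \<union> ?X2 \<union> ?X3" "?X1 \<inter> ?X2 = {}" "(?X1 \<union> ?X2) \<inter> ?X3 = {}"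
    by auto
  have "card ?X = card (?X1 \<union> ?X2 \<union> ?X3)" by (rule arg_cong[OF dec(1)])
  also have "\<dots> = card (?X1 \<union> ?X2) + card ?X3"
    by (rule card_Un_disjoint[OF finite_UnI[OF fin(1,2)] fin(3) dec(3)])
  also have "card (?X1 \<union> ?X2) = card ?X1 + card ?X2"
    by (rule card_Un_disjoint[OF fin(1,2) dec(2)])
  finally have card_X: "card ?X = card ?X1 + card ?X2 + card ?X3" .

  have card_X1: "card ?X1 = (if u then \<Sum>S\<in>Pow C. card (tagged_parts u r z (C - S)) else 0)"
  proof (cases u)
    case True
    let ?G = "\<lambda>S. tagged_parts_over u r z ?C {insert x S} Map.empty"
    have "?X1 = (\<Union>S\<in>Pow C. ?G S)"
    proof (intro equalityI subrelI)
      fix P t assume a: "(P, t) \<in> ?X1"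
      then have "(P, t) \<in> ?G (class_of P x - {x})"
        using cls_mem[of P t] by (simp add: tagged_parts_over_def)
      then show "(P, t) \<in> (\<Union>S\<in>Pow C. ?G S)" using a cls_mem(3)[of P t] by blast
    next
      fix P t assume "(P, t) \<in> (\<Union>S\<in>Pow C. ?G S)"
      then show "(P, t) \<in> ?X1" using overD[of P t] by fastforce
    qed
    moreover have "card (\<Union>S\<in>Pow C. ?G S) = (\<Sum>S\<in>Pow C. card (?G S))"
    proof (rule card_UN_key)
      show "class_of (fst y) x - {x} = S" if "S \<in> Pow C" "y \<in> ?G S" for S y
        using overD(2)[of "fst y" "snd y" _ _ S] that C(2) by (cases y) auto
    qed (use C in \<open>auto simp: finite_tagged_parts_over\<close>)
    moreover have "card (?G S) = card (tagged_parts u r z (C - S))" if "S \<in> Pow C" for S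
    proof -
      have "?C - insert x S = C - S" using C(2) by auto
      then show ?thesis using card_tagged_parts_over_untagged[OF C', of "insert x S"] True that by auto
    qed
    ultimately show ?thesis using True by simp
  next
    case False
    then have e: "?X1 = {}" using cls_mem(1) tagged_partsD(6) by blast
    show ?thesis unfolding e using False by simp
  qed

  have card_X2: "card ?X2 = (if z then card (tagged_parts u r True C) else 0)"
  proof (cases z)
    case True
    let ?G = "\<lambda>S. tagged_parts_over u r z ?C {insert x S} [insert x S \<mapsto> insert x S]"
    have "?X2 = (\<Union>S\<in>Pow C. ?G S)"
    proof (intro equalityI subrelI)
      fix P t assume a: "(P, t) \<in> ?X2"
      then have "(P, t) \<in> ?G (class_of P x - {x})"
        using cls_mem[of P t] by (simp add: tagged_parts_over_def)
      then show "(P, t) \<in> (\<Union>S\<in>Pow C. ?G S)" using a cls_mem(3)[of P t] by blast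
    next
      fix P t assume "(P, t) \<in> (\<Union>S\<in>Pow C. ?G S)"
      then show "(P, t) \<in> ?X2" using overD[of P t] by fastforce
    qed
    moreover have "card (\<Union>S\<in>Pow C. ?G S) = (\<Sum>S\<in>Pow C. card (?G S))"
    proof (rule card_UN_key)
      show "class_of (fst y) x - {x} = S" if "S \<in> Pow C" "y \<in> ?G S" for S y
        using overD(2)[of "fst y" "snd y" _ _ S] that C(2) by (cases y) auto
    qed (use C in \<open>auto simp: finite_tagged_parts_over\<close>)
    moreover have "card (?G S) = card (tagged_parts u r False (C - S))" if "S \<in> Pow C" for S
    proof -
      have "?C - insert x S = C - S" using C(2) by auto
      then show ?thesis using card_tagged_parts_over_fixed[OF C', of "insert x S"] True that by auto
    qed
    \<comment> \<open>The counts on \<open>C - S\<close> without a fixed point add up to the count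
      on \<open>C\<close> with a fixed point allowed.\<close>
    ultimately show ?thesis using True card_tagged_parts_True[OF C(1)] by simp
  next
    case False
    then have "t A \<noteq> Some A" if "(P, t) \<in> ?X" for P t A
      using tagged_partsD(5)[OF that, of A A] by auto
    then have e: "?X2 = {}" by blast
    show ?thesis unfolding e using False by simp
  qed

  have card_X3: "card ?X3 = (\<Sum>K\<in>Pow C. \<Sum>S\<in>Pow (C - K) - {C - K}.
         if r (card S + 1) (card (C - K) - card S) then card (tagged_parts u r z K) else 0)"
  proof -
    let ?I = "Sigma (Pow C) (\<lambda>K. Pow (C - K) - {C - K})"
    let ?A = "\<lambda>S. insert x S" and ?B = "\<lambda>K S. C - K - S"
    let ?G = "\<lambda>(K, S). tagged_parts_over u r z ?C {?A S, ?B K S} [?A S \<mapsto> ?B K S, ?B K S \<mapsto> ?A S]"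
    \<comment> \<open>The point \<open>x\<close> distinguishes the partners, so the two updates of
      the map do not overwrite each other.\<close>
    have AB: "?A S \<noteq> ?B K S" for K S using C(2) by auto
    have "?X3 = (\<Union>i\<in>?I. ?G i)"
    proof (intro equalityI subrelI)
      fix P t assume "(P, t) \<in> ?X3"
      then obtain B where a: "(P, t) \<in> ?X" and B: "t (class_of P x) = Some B" "B \<noteq> class_of P x"
        by auto
      note t = tagged_partsD[OF a] and c = cls_mem[OF a]
      define S where "S = class_of P x - {x}"
      define K where "K = C - S - B"
      have A: "class_of P x = insert x S" and S: "S \<subseteq> C" using c(2,3) by (simp_all add: S_def)
      have BP: "B \<in> P" using t(7) B(1) by blast
      then have "B \<inter> class_of P x = {}" using c(1) B(2) t(1) by (meson disjointD partition_onD2)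
      then have "B \<inter> insert x S = {}" by (simp add: A)
      moreover have "B \<subseteq> insert x C" "B \<noteq> {}" using BP t(1) by (auto simp: partition_on_def)
      ultimately have BC: "B \<subseteq> C" "B \<inter> S = {}" "B \<noteq> {}" by auto
      then have Beq: "C - K - S = B" using S by (auto simp: K_def)
      have "(K, S) \<in> ?I" using S BC by (auto simp: K_def)
      moreover have "(P, t) \<in> ?G (K, S)"
        using a c(1) BP B t(3)[OF B(1)] AB[of S K]
        unfolding tagged_parts_over_def by (simp add: A Beq)
      ultimately show "(P, t) \<in> (\<Union>i\<in>?I. ?G i)" by blast
    next
      fix P t assume "(P, t) \<in> (\<Union>i\<in>?I. ?G i)"
      then obtain K S where "(P, t) \<in> ?G (K, S)" by blast
      then have "(P, t) \<in> tagged_parts_over u r z ?C {?A S, ?B K S} [?A S \<mapsto> ?B K S, ?B K S \<mapsto> ?A S]" by simp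
      from overD[OF this, of S] show "(P, t) \<in> ?X3" using AB[of S K] by simp
    qed
    moreover have "card (\<Union>i\<in>?I. ?G i) = (\<Sum>i\<in>?I. card (?G i))"
    proof (rule card_UN_key)
      \<comment> \<open>\<open>S\<close> is the class of \<open>x\<close> without \<open>x\<close>,
        and \<open>K\<close> is what is left of \<open>C\<close> without \<open>S\<close> and the
        partner; members of \<open>?G\<close> have a tag on the class of \<open>x\<close>, so
        \<open>the\<close> is harmless.\<close>
      let ?key = "\<lambda>(P, t). (C - (class_of P x - {x}) - the (t (class_of P x)), class_of P x - {x})"
      fix i y assume "i \<in> ?I" "y \<in> ?G i"
      then obtain K S P t where i: "i = (K, S)" "K \<subseteq> C" "S \<subseteq> C - K" "y = (P, t)"
        and "(P, t) \<in> tagged_parts_over u r z ?C {?A S, ?B K S} [?A S \<mapsto> ?B K S, ?B K S \<mapsto> ?A S]"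
        by (cases i; cases y) auto
      from overD(2,3)[OF this(5), of S]
      have "class_of P x = insert x S" "t (insert x S) = Some (C - K - S)"
        using AB[of S K] by simp_all
      moreover have "insert x S - {x} = S" "C - S - (C - K - S) = K" using i(2,3) C(2) by auto
      ultimately show "?key y = i" by (simp add: i)
    qed (use C in \<open>auto simp: finite_tagged_parts_over intro: finite_subset\<close>)
    moreover have "card (?G (K, S)) =
        (if r (card S + 1) (card (C - K) - card S) then card (tagged_parts u r z K) else 0)"
      if i: "(K, S) \<in> ?I" for K S
    proof -
      have KS: "K \<subseteq> C" "S \<subseteq> C - K" "S \<noteq> C - K" using i by auto
      then have cS: "card (?A S) = card S + 1" "card (?B K S) = card (C - K) - card S"
      proof -
        have "finite S" "x \<notin> S" using KS(2) C by (auto intro: finite_subset)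
        then show "card (?A S) = card S + 1" "card (?B K S) = card (C - K) - card S"
          using KS(2) by (simp_all add: card_Diff_subset)
      qed
      show ?thesis
      proof (cases "r (card (?A S)) (card (?B K S))")
        case True
        have "?C - (?A S \<union> ?B K S) = K" using KS C(2) by auto
        moreover have "?A S \<subseteq> ?C" "?B K S \<subseteq> ?C" "?B K S \<noteq> {}" "?A S \<inter> ?B K S = {}"
          using KS C(2) by auto
        \<comment> \<open>Symmetry of \<open>r\<close> supplies the size condition in the reverse
          order.\<close>
        ultimately have "card (?G (K, S)) = card (tagged_parts u r z K)"
          using card_tagged_parts_over_pair[OF C', of "?A S" "?B K S" r u z] True r by simp
        then show ?thesis using True cS by simp
      next
        case False
        \<comment> \<open>Sizes violating \<open>r\<close> rule out this pair of partners, so the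
          count is 0 like the summand.\<close>
        have "?G (K, S) = {}"
        proof (rule equals0I)
          fix y assume "y \<in> ?G (K, S)"
          then obtain P t where
            "(P, t) \<in> tagged_parts_over u r z ?C {?A S, ?B K S} [?A S \<mapsto> ?B K S, ?B K S \<mapsto> ?A S]"
            by (cases y) auto
          from overD[OF this, of S] have "(P, t) \<in> ?X" "t (?A S) = Some (?B K S)"
            using AB[of S K] by auto
          then show False using tagged_partsD(5)[of P t u r z ?C "?A S" "?B K S"] False AB[of S K] by simp
        qed
        then show ?thesis using False cS by simp
      qed
    qed
    then have "(\<Sum>i\<in>?I. card (?G i)) = (\<Sum>(K, S)\<in>?I.
        if r (card S + 1) (card (C - K) - card S) then card (tagged_parts u r z K) else 0)"
      by (intro sum.cong[OF refl]) (simp only: split_paired_all case_prod_conv)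
    ultimately have "card ?X3 = (\<Sum>(K, S)\<in>?I.
        if r (card S + 1) (card (C - K) - card S) then card (tagged_parts u r z K) else 0)"
      by (simp only:)
    then show ?thesis using C(1) by (subst sum.Sigma) (auto intro: finite_subset)
  qed

  show ?thesis using card_X card_X1 card_X2 card_X3 by simp
qed

section \<open>The recursion in terms of cardinalities\<close>

text \<open>Grouping subsets by size turns the sums over subsets into binomial sums, and two nested
  choices give the trinomial coefficient. The assumption on \<open>g\<close> concerns subsets of
  \<open>C\<close> only, which is what an induction on the cardinality can provide.\<close>

lemma card_tagged_parts_step:
  fixes g :: "nat \<Rightarrow> nat"
  assumes C: "finite C" "x \<notin> C" and r: "\<And>a b. r a b = r b a"
    and g: "\<And>D. D \<subseteq> C \<Longrightarrow> card (tagged_parts u r z D) = g (card D)"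
  shows "card (tagged_parts u r z (insert x C)) =
      (if u then \<Sum>k\<le>card C. (card C choose k) * g k else 0)
    + (if z then g (card C) else 0)
    + (\<Sum>(k, l)\<in>{(k, l). k + l < card C}.
         if r (l + 1) (card C - k - l) then trinomial (card C) k l * g k else 0)"
proof -
  let ?n = "card C"
  have "(\<Sum>S\<in>Pow C. card (tagged_parts u r z (C - S))) = (\<Sum>S\<in>Pow C. g (card S))"
    by (rule sum.reindex_bij_witness[of _ "\<lambda>S. C - S" "\<lambda>S. C - S"]) (auto simp: g double_diff)
  then have U: "(\<Sum>S\<in>Pow C. card (tagged_parts u r z (C - S))) = (\<Sum>k\<le>?n. (?n choose k) * g k)"
    using sum_Pow_card[OF C(1)] by simp
  define h where "h k l = (if r (l + 1) (?n - k - l) then g k else 0)" for k l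
  have inner: "(\<Sum>S\<in>Pow (C - K) - {C - K}.
         if r (card S + 1) (card (C - K) - card S) then card (tagged_parts u r z K) else 0)
       = (\<Sum>l<?n - card K. ((?n - card K) choose l) * h (card K) l)" if K: "K \<in> Pow C" for K
  proof -
    have fin: "finite (C - K)" and cD: "card (C - K) = ?n - card K"
      using C K by (auto simp: card_Diff_subset finite_subset)
    \<comment> \<open>\<open>sum_Pow_card\<close> speaks of the whole power set. The added subset
      \<open>S = C - K\<close> gives the term at \<open>l = card (C - K)\<close>, whose coefficient
      is 1, so it cancels.\<close>
    have "(\<Sum>S\<in>Pow (C - K). h (card K) (card S)) =
        h (card K) (card (C - K)) + (\<Sum>S\<in>Pow (C - K) - {C - K}. h (card K) (card S))"
      using fin by (intro sum.remove) auto
    moreover have "(\<Sum>S\<in>Pow (C - K). h (card K) (card S)) =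
        (\<Sum>l<card (C - K). (card (C - K) choose l) * h (card K) l) + h (card K) (card (C - K))"
      using sum_Pow_card[OF fin, of "h (card K)"]
      by (simp only: lessThan_Suc_atMost[symmetric] sum.lessThan_Suc binomial_n_n mult_1)
    moreover have "card (tagged_parts u r z K) = g (card K)" using K by (simp add: g)
    ultimately show ?thesis by (simp add: h_def cD cong: if_cong)
  qed
  have "(\<Sum>K\<in>Pow C. \<Sum>S\<in>Pow (C - K) - {C - K}.
         if r (card S + 1) (card (C - K) - card S) then card (tagged_parts u r z K) else 0)
       = (\<Sum>K\<in>Pow C. \<Sum>l<?n - card K. ((?n - card K) choose l) * h (card K) l)"
    using inner by (intro sum.cong refl)
  also have "\<dots> = (\<Sum>k\<le>?n. (?n choose k) * (\<Sum>l<?n - k. ((?n - k) choose l) * h k l))"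
    by (rule sum_Pow_card[OF C(1)])
  also have "\<dots> = (\<Sum>(k, l)\<in>Sigma {..?n} (\<lambda>k. {..<?n - k}).
      (?n choose k) * (((?n - k) choose l) * h k l))"
    by (simp add: sum_distrib_left sum.Sigma)
  also have "\<dots> = (\<Sum>(k, l)\<in>{(k, l). k + l < ?n}.
      if r (l + 1) (?n - k - l) then trinomial ?n k l * g k else 0)"
    by (rule sum.cong) (auto simp: h_def trinomial_eq_binomial)
  finally have paired: "(\<Sum>K\<in>Pow C. \<Sum>S\<in>Pow (C - K) - {C - K}.
         if r (card S + 1) (card (C - K) - card S) then card (tagged_parts u r z K) else 0)
       = (\<Sum>(k, l)\<in>{(k, l). k + l < ?n}.
         if r (l + 1) (?n - k - l) then trinomial ?n k l * g k else 0)" .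
  have Z: "(if z then card (tagged_parts u r True C) else 0) = (if z then g ?n else 0)"
    using g[of C] by (cases z) simp_all
  show ?thesis
    unfolding card_tagged_parts_insert[where u = u and z = z and r = r, OF C r] U Z paired ..
qed

text \<open>No bijection is transported to tagged partitions: by induction, the recursion expresses
  the counts for \<open>insert x D\<close> and for \<open>insert (Suc n) {1..n}\<close> by the same
  formula in the same \<open>g\<close>.\<close>

lemma card_tagged_parts_card:
  fixes C :: "nat set"
  assumes "finite C" and r: "\<And>a b. r a b = r b a"
  shows "card (tagged_parts u r z C) = card (tagged_parts u r z {1..card C})"
  using assms(1)
proof (induction "card C" arbitrary: C rule: less_induct)
  case less
  define g where "g k = card (tagged_parts u r z {1..k})" for k :: nat
  show ?case
  proof (cases "card C")
    case 0
    then show ?thesis using less.prems by simp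
  next
    case (Suc n)
    then obtain x D where C: "C = insert x D" "x \<notin> D" by (metis card_Suc_eq)
    then have D: "finite D" "card D = n" using less.prems Suc by auto
    have card_upto: "card {1..n} = n" by simp
    have IH: "card (tagged_parts u r z E) = g (card E)" if "finite E" "card E \<le> n" for E :: "nat set"
      using less.hyps[of E] that Suc unfolding g_def by simp
    have "card (tagged_parts u r z E) = g (card E)" if "E \<subseteq> D" for E
      using that D by (intro IH) (auto intro: finite_subset card_mono)
    note step1 = card_tagged_parts_step[OF D(1) C(2) r this, unfolded D(2)]
    have "card (tagged_parts u r z E) = g (card E)" if "E \<subseteq> {1..n}" for E
    proof -
      have "finite E" using that finite_subset by blast
      moreover have "card E \<le> n" using card_mono[OF _ that] by simp
      ultimately show ?thesis by (rule IH)
    qed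
    note step2 = card_tagged_parts_step[of "{1..n}" "Suc n", OF _ _ r this, unfolded card_upto]
    have "{1..Suc n} = insert (Suc n) {1..n}" by auto
    then show ?thesis using step1 step2 C Suc D(2) by simp
  qed
qed

text \<open>All four recursions are instances of this one. In the last sum, \<open>l + 1\<close> is
  the size of the class of the new point and \<open>n - k - l\<close> that of its partner.\<close>

lemma card_tagged_parts_recursion:
  assumes r: "\<And>a b. r a b = r b a"
  shows "card (tagged_parts u r z {1..n + 1}) =
      (if u then \<Sum>k=0..n. (n choose k) * card (tagged_parts u r z {1..k}) else 0)
    + (if z then card (tagged_parts u r z {1..n}) else 0)
    + (\<Sum>(k, l)\<in>{(k, l). k + l < n}.
         if r (l + 1) (n - k - l) then trinomial n k l * card (tagged_parts u r z {1..k}) else 0)"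
proof -
  have "card (tagged_parts u r z E) = card (tagged_parts u r z {1..card E})" if "E \<subseteq> {1..n}" for E
    using that by (intro card_tagged_parts_card r) (auto intro: finite_subset)
  note step = card_tagged_parts_step[of "{1..n}" "Suc n" r u z "\<lambda>k. card (tagged_parts u r z {1..k})", OF _ _ r this]
  have card_upto: "card {1..n} = n" by simp
  have "{1..n + 1} = insert (Suc n) {1..n}" by auto
  then show ?thesis using step[unfolded card_upto] by (simp add: atLeast0AtMost)
qed

section \<open>Recovering a tagged partition from its subspace\<close>

text \<open>Of two distinct classes at most one is its own partner, so the signed indicator of at
  least one of them lies in the subspace. It is 1 on its own class and 0 or -1 on the second one,
  which refutes \<open>x i = x j\<close>; if the classes are not partners, the second value is 0,
  which refutes \<open>x i = - x j\<close>.\<close>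

lemma polydiagonal_class_eq_iff:
  assumes part: "tagged_partition {1..n} P t" and i: "i \<in> {1..n}" and j: "j \<in> {1..n}"
  shows "class_of P i = class_of P j \<longleftrightarrow> (\<forall>x\<in>polydiagonal n P t. x i = x j)"
    and "t (class_of P i) = Some (class_of P j) \<longleftrightarrow> (\<forall>x\<in>polydiagonal n P t. x i = - x j)"
proof -
  have P: "(P, t) \<in> tagged_parts True (\<lambda>_ _. True) True {1..n}" using part by (simp add: tagged_parts_def)
  note t = tagged_partsD(3,4)[OF P]
  \<comment> \<open>Signed indicator of \<open>A\<close>; it lies in the subspace unless \<open>A\<close> is its own partner.\<close>
  define w where "w A = (\<lambda>k\<in>{1..n}. if class_of P k = A then 1
      else if t A = Some (class_of P k) then - 1 else (0::real))" for A
  have w: "w A \<in> polydiagonal n P t" if A: "t A \<noteq> Some A" for A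
  proof -
    have "w A k = - w A l"
      if "k \<in> {1..n}" "l \<in> {1..n}" "t (class_of P k) = Some (class_of P l)" for k l
    proof (cases "class_of P k = A")
      \<comment> \<open>Now \<open>class_of P l\<close> is the partner of \<open>A\<close>; the
        values 1 and -1 require it to differ from \<open>A\<close>, which is the assumption on
        \<open>A\<close>.\<close>
      case True
      then show ?thesis using that A by (auto simp: w_def)
    next
      case kA: False
      have tl: "t (class_of P l) = Some (class_of P k)" using that(3) by (rule t(1))
      \<comment> \<open>Either \<open>class_of P k\<close> is the partner of \<open>A\<close>, and
        then \<open>class_of P l\<close> is \<open>A\<close>, or both points lie outside
        \<open>A\<close> and its partner, where \<open>w A\<close> is 0.\<close>
      show ?thesis
      proof (cases "t A = Some (class_of P k)")
        case True
        then have "class_of P l = A" using t(1)[OF True] that(3) by simp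
        then show ?thesis using that True kA by (simp add: w_def)
      next
        case False
        then have "class_of P l \<noteq> A" using tl by auto
        moreover have "t A \<noteq> Some (class_of P l)" using t(1)[of A "class_of P l"] tl kA by auto
        ultimately show ?thesis using that False kA by (simp add: w_def)
      qed
    qed
    moreover have "w A k = w A l"
      if "k \<in> {1..n}" "l \<in> {1..n}" "class_of P k = class_of P l" for k l
      using that by (simp add: w_def)
    moreover have "w A \<in> {1..n} \<rightarrow>\<^sub>E UNIV" by (simp add: w_def)
    ultimately show ?thesis unfolding polydiagonal_def by blast
  qed
  have unfixed: "t (class_of P i) \<noteq> Some (class_of P i) \<or> t (class_of P j) \<noteq> Some (class_of P j)"
    if "class_of P i \<noteq> class_of P j"
    using that t(2) by blast
  show "class_of P i = class_of P j \<longleftrightarrow> (\<forall>x\<in>polydiagonal n P t. x i = x j)"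
  proof
    assume "class_of P i = class_of P j"
    then show "\<forall>x\<in>polydiagonal n P t. x i = x j" using i j unfolding polydiagonal_def by blast
  next
    assume eq: "\<forall>x\<in>polydiagonal n P t. x i = x j"
    show "class_of P i = class_of P j"
    proof (rule ccontr)
      assume ne: "class_of P i \<noteq> class_of P j"
      from unfixed[OF this] show False
      proof
        assume "t (class_of P i) \<noteq> Some (class_of P i)"
        from eq w[OF this] have "w (class_of P i) i = w (class_of P i) j" by blast
        then show False using i j ne by (simp add: w_def split: if_splits)
      next
        assume "t (class_of P j) \<noteq> Some (class_of P j)"
        from eq w[OF this] have "w (class_of P j) i = w (class_of P j) j" by blast
        then show False using i j ne by (simp add: w_def split: if_splits)
      qed
    qed
  qed
  show "t (class_of P i) = Some (class_of P j) \<longleftrightarrow> (\<forall>x\<in>polydiagonal n P t. x i = - x j)"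
  proof
    assume "t (class_of P i) = Some (class_of P j)"
    then show "\<forall>x\<in>polydiagonal n P t. x i = - x j" using i j unfolding polydiagonal_def by blast
  next
    assume eq: "\<forall>x\<in>polydiagonal n P t. x i = - x j"
    show "t (class_of P i) = Some (class_of P j)"
    proof (rule ccontr)
      assume ne: "t (class_of P i) \<noteq> Some (class_of P j)"
      then have ne': "t (class_of P j) \<noteq> Some (class_of P i)" using t(1) by blast
      \<comment> \<open>If \<open>i\<close> and \<open>j\<close> share a class,
        \<open>unfixed\<close> does not apply, but then \<open>ne\<close> itself says that this
        class is not its own partner.\<close>
      have "t (class_of P i) \<noteq> Some (class_of P i) \<or> t (class_of P j) \<noteq> Some (class_of P j)"
        using unfixed ne by metis
      then show False
      proof
        assume "t (class_of P i) \<noteq> Some (class_of P i)"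
        from eq w[OF this] have "w (class_of P i) i = - w (class_of P i) j" by blast
        then show False using i j ne by (simp add: w_def split: if_splits)
      next
        assume "t (class_of P j) \<noteq> Some (class_of P j)"
        from eq w[OF this] have "w (class_of P j) i = - w (class_of P j) j" by blast
        then show False using i j ne' by (simp add: w_def split: if_splits)
      qed
    qed
  qed
qed

lemma partition_on_eqI:
  assumes P: "partition_on C P" and Q: "partition_on C Q"
    and eq: "\<And>i j. i \<in> C \<Longrightarrow> j \<in> C \<Longrightarrow> class_of P i = class_of P j \<longleftrightarrow> class_of Q i = class_of Q j"
  shows "P = Q"
proof -
  \<comment> \<open>A partition is written in terms of its equivalence relation on \<open>C\<close>
    alone, so equal relations give equal partitions.\<close>
  have image: "R = (\<lambda>i. {j \<in> C. class_of R i = class_of R j}) ` C" if R: "partition_on C R" for R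
  proof -
    have cls: "{j \<in> C. A = class_of R j} = A" if "A \<in> R" for A
    proof -
      have "A \<subseteq> C" using that R by (auto simp: partition_on_def)
      then show ?thesis using class_of_eq[OF R that] class_of_mem(2)[OF R] by auto
    qed
    have "A \<in> class_of R ` C" if A: "A \<in> R" for A
    proof -
      have "A \<noteq> {}" using A partition_onD3[OF R] by blast
      then obtain i where i: "i \<in> A" by blast
      then have "i \<in> C" using A R by (auto simp: partition_on_def)
      then show ?thesis using class_of_eq[OF R A i] by blast
    qed
    then have "R = class_of R ` C" using class_of_mem(1)[OF R] by blast
    also have "\<dots> = (\<lambda>i. {j \<in> C. class_of R i = class_of R j}) ` C"
      using cls class_of_mem(1)[OF R] by (intro image_cong refl) simp
    finally show ?thesis .
  qed
  show ?thesis
    by (subst image[OF P], subst image[OF Q]) (use eq in \<open>auto intro!: image_cong\<close>)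
qed

lemma polydiagonal_inj:
  assumes P: "tagged_partition {1..n} P t" and Q: "tagged_partition {1..n} Q u"
    and eq: "polydiagonal n P t = polydiagonal n Q u"
  shows "P = Q \<and> t = u"
proof -
  have tP: "(P, t) \<in> tagged_parts True (\<lambda>_ _. True) True {1..n}"
    and tQ: "(Q, u) \<in> tagged_parts True (\<lambda>_ _. True) True {1..n}"
    using P Q by (simp_all add: tagged_parts_def)
  note part = tagged_partsD(1)[OF tP] tagged_partsD(1)[OF tQ]
  have PQ: "P = Q"
    using part by (rule partition_on_eqI)
      (simp only: polydiagonal_class_eq_iff(1)[OF P] polydiagonal_class_eq_iff(1)[OF Q] eq)
  \<comment> \<open>The tag relation is known for classes of points only; being nonempty, every
    member of \<open>P\<close> is one.\<close>
  have rep: "\<exists>i\<in>{1..n}. A = class_of P i" if A: "A \<in> P" for A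
  proof -
    have "A \<noteq> {}" using A partition_onD3[OF part(1)] by blast
    then obtain i where i: "i \<in> A" by blast
    then have "i \<in> {1..n}" using A part(1) unfolding partition_on_def by blast
    then show ?thesis using class_of_eq[OF part(1) A i] by blast
  qed
  have iff: "t A = Some B \<longleftrightarrow> u A = Some B" if AB: "A \<in> P" "B \<in> P" for A B
  proof -
    obtain i j where ij: "i \<in> {1..n}" "j \<in> {1..n}" "A = class_of P i" "B = class_of P j"
      using rep[OF AB(1)] rep[OF AB(2)] by blast
    show ?thesis
      using polydiagonal_class_eq_iff(2)[OF P ij(1,2)] polydiagonal_class_eq_iff(2)[OF Q ij(1,2)]
      unfolding eq by (simp only: ij PQ)
  qed
  \<comment> \<open>Domains and ranges of both maps lie in \<open>P\<close>, so agreement there is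
    agreement everywhere.\<close>
  have "t A = Some B \<longleftrightarrow> u A = Some B" for A B
    using iff[of A B] tagged_partsD(2,7)[OF tP] tagged_partsD(2,7)[OF tQ] PQ by blast
  then have "t A = u A" for A by (metis not_Some_eq)
  with PQ show ?thesis by blast
qed

section \<open>Counting the subspaces\<close>

lemma card_polydiagonal_image:
  assumes "\<And>P t. (P, t) \<in> T \<Longrightarrow> tagged_partition {1..n} P t"
  shows "card {polydiagonal n P t | P t. (P, t) \<in> T} = card T"
proof -
  have "{polydiagonal n P t | P t. (P, t) \<in> T} = (\<lambda>(P, t). polydiagonal n P t) ` T"
    by force
  moreover have "inj_on (\<lambda>(P, t). polydiagonal n P t) T"
    using assms polydiagonal_inj by (intro inj_onI) (clarify, blast)
  ultimately show ?thesis by (simp add: card_image)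
qed

text \<open>A constantly false \<open>r\<close> together with a false \<open>z\<close> forbids every
  tag, which leaves the empty map. For evenly tagged partitions \<open>r\<close> is equality of
  sizes, which holds trivially at a fixed point, so \<open>z\<close> stays true.\<close>

lemma num_eq_card_tagged_parts:
  shows "num_polydiagonal n = card (tagged_parts True (\<lambda>_ _. True) True {1..n})"
    and "num_synchrony n = card (tagged_parts True (\<lambda>_ _. False) False {1..n})"
    and "num_fully_tagged n = card (tagged_parts False (\<lambda>_ _. True) True {1..n})"
    and "num_evenly_tagged n = card (tagged_parts False (=) True {1..n})"
proof -
  have T: "tagged_partition {1..n} P t" if "(P, t) \<in> tagged_parts u r z {1..n}" for P t u r z
    using that by (simp add: tagged_parts_def)
  have full: "fully_tagged P t \<longleftrightarrow> P \<subseteq> dom t" if "tagged_partition {1..n} P t" for P t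
    using that by (auto simp: fully_tagged_def tagged_partition_def partial_involution_on_def)
  have "tagged_partition {1..n} P t \<longleftrightarrow> (P, t) \<in> tagged_parts True (\<lambda>_ _. True) True {1..n}" for P t
    by (simp add: tagged_parts_def)
  then show "num_polydiagonal n = card (tagged_parts True (\<lambda>_ _. True) True {1..n})"
    unfolding num_polydiagonal_def polydiagonal_subspaces_def
    using card_polydiagonal_image[OF T] by simp
  have "tagged_partition {1..n} P t \<and> t = Map.empty \<longleftrightarrow>
      (P, t) \<in> tagged_parts True (\<lambda>_ _. False) False {1..n}" for P t
    by (auto simp: tagged_parts_def fun_eq_iff intro: option.exhaust)
  then show "num_synchrony n = card (tagged_parts True (\<lambda>_ _. False) False {1..n})"
    unfolding num_synchrony_def synchrony_subspaces_def
    using card_polydiagonal_image[OF T] by simp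
  have "tagged_partition {1..n} P t \<and> fully_tagged P t \<longleftrightarrow>
      (P, t) \<in> tagged_parts False (\<lambda>_ _. True) True {1..n}" for P t
    using full[of P t] by (auto simp: tagged_parts_def)
  then show "num_fully_tagged n = card (tagged_parts False (\<lambda>_ _. True) True {1..n})"
    unfolding num_fully_tagged_def fully_tagged_subspaces_def
    using card_polydiagonal_image[OF T] by simp
  have "tagged_partition {1..n} P t \<and> evenly_tagged P t \<longleftrightarrow>
      (P, t) \<in> tagged_parts False (=) True {1..n}" for P t
  proof -
    have "(if A = B then True else card A = card B) \<longleftrightarrow> card A = card B" for A B :: "nat set"
      by simp
    then show ?thesis using full[of P t] unfolding tagged_parts_def evenly_tagged_def by auto
  qed
  then show "num_evenly_tagged n = card (tagged_parts False (=) True {1..n})"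
    unfolding num_evenly_tagged_def evenly_tagged_subspaces_def
    using card_polydiagonal_image[OF T] by simp
qed

theorem proposition7p20:
  fixes n :: nat
  shows
    "num_polydiagonal (n + 1) =
       num_polydiagonal n
       + (\<Sum>(k, l)\<in>{(k, l). k + l < n}. trinomial n k l * num_polydiagonal k)
       + (\<Sum>k=0..n. (n choose k) * num_polydiagonal k) \<and>
     num_synchrony (n + 1) = (\<Sum>k=0..n. (n choose k) * num_synchrony k) \<and>
     num_fully_tagged (n + 1) =
       num_fully_tagged n
       + (\<Sum>(k, l)\<in>{(k, l). k + l < n}. trinomial n k l * num_fully_tagged k) \<and>
     num_evenly_tagged (n + 1) =
       num_evenly_tagged n
       + (\<Sum>(k, l)\<in>{(k, l). k + 2 * l + 1 = n}. trinomial n k l * num_evenly_tagged k)"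
proof -
  have fin: "finite {(k, l). k + l < n}"
    by (rule finite_subset[of _ "{..n} \<times> {..n}"]) auto
  \<comment> \<open>For \<open>k + l < n\<close> the condition \<open>l + 1 = n - k - l\<close>
    means \<open>k + 2 * l + 1 = n\<close>; the other pairs contribute 0 and are dropped.\<close>
  have "(\<Sum>(k, l)\<in>{(k, l). k + l < n}.
      if l + 1 = n - k - l then trinomial n k l * num_evenly_tagged k else 0)
    = (\<Sum>(k, l)\<in>{(k, l). k + 2 * l + 1 = n}. trinomial n k l * num_evenly_tagged k)"
    by (rule sum.mono_neutral_cong_right[OF fin]) (auto split: if_splits)
  then have evenly: "num_evenly_tagged (n + 1) = num_evenly_tagged n
      + (\<Sum>(k, l)\<in>{(k, l). k + 2 * l + 1 = n}. trinomial n k l * num_evenly_tagged k)"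
    using card_tagged_parts_recursion[of "(=)" False True n, folded num_eq_card_tagged_parts] by (simp add: eq_commute)
  show ?thesis
    unfolding evenly
    \<comment> \<open>A false \<open>u\<close> removes the binomial sum, a false \<open>z\<close>
      the term at \<open>n\<close>, and a constantly false \<open>r\<close> the trinomial
      sum.\<close>
    using card_tagged_parts_recursion[of "\<lambda>_ _. True" True True n]
      card_tagged_parts_recursion[of "\<lambda>_ _. False" True False n]
      card_tagged_parts_recursion[of "\<lambda>_ _. True" False True n]
    by (simp add: num_eq_card_tagged_parts)
qed

end
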